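(* $m^*(192)=9$, $m^*(208)=8$ and $m^*(224)=8$.
   Context: A Littlewood polynomial (LP) of length $n$ is a polynomial $f(x)=\sum_{i=0}^{n-1}a_ix^i$ with every $a_i\in\{1,-1\}$; it has order $m$ if $(x-1)^m$ divides $f(x)$. $\mathcal{P}(n,m)$ denotes the set of LPs of length $n$ and order $m$. For a positive integer $n$, $m^*(n)$ is the largest positive integer $m$ such that $\mathcal{P}(n,m)\neq\varnothing$. *)

theory Defs
  imports Complex_Main "HOL-Computational_Algebra.Polynomial"
begin

definition littlewood :: "nat \<Rightarrow> int poly \<Rightarrow> bool" where
  "littlewood n f \<longleftrightarrow>
     (\<exists>a :: nat \<Rightarrow> int. (\<forall>i<n. a i \<in> {1, -1}) \<and> f = (\<Sum>i<n. monom (a i) i))"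

text \<open>Divisibility is taken in the ring of integer polynomials; as \<open>(x - 1)^m\<close> is monic,
  this agrees with divisibility over the rationals, reals or complex numbers.\<close>

definition LP :: "nat \<Rightarrow> nat \<Rightarrow> int poly set" where
  "LP n m = {f. littlewood n f \<and> [:-1, 1:] ^ m dvd f}"

text \<open>For odd \<open>n\<close> no positive \<open>m\<close> qualifies and the value is unspecified; for even
  \<open>n \<ge> 2\<close> the qualifying \<open>m\<close> include 1 and are bounded by \<open>n - 1\<close>.\<close>

definition m_star :: "nat \<Rightarrow> nat" where
  "m_star n = (GREATEST m. m > 0 \<and> LP n m \<noteq> {})"

end

theory Submission
  imports Defs "HOL-Number_Theory.Cong"
begin

text \<open>
  If \<open>(x - 1)^m\<close> divides \<open>f\<close>, then folding \<open>f\<close> modulo \<open>x^p - 1\<close> for a prime \<open>p\<close> gives residue class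
  sums of the coefficients that are divisible by a high power of \<open>p\<close>, because \<open>p\<close> is up to a unit
  \<open>(1 - \<zeta>)^(p - 1)\<close> for a primitive \<open>p\<close>-th root of unity \<open>\<zeta>\<close>. The sum over a class of \<open>k\<close> signs
  has absolute value at most \<open>k\<close> and the parity of \<open>k\<close>. For \<open>m = 9\<close>, \<open>p = 3\<close> the class sums are
  divisible by 81, while for lengths 208 and 224 some class has odd size below 81. For \<open>m = 10\<close>,
  \<open>p = 5\<close> and length 192 divisibility by 25 forces the class sums \<open>(\<plusminus>25, \<plusminus>25, 0, 0, 0)\<close>, which
  contradicts a linear relation modulo 125. The lower bounds come from explicit polynomials, found
  by a meet-in-the-middle search among the reciprocal and skew-reciprocal ones that respects these
  class sums.
\<close>

section \<open>Residue class sums of multiples of (x - 1)^m\<close>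

definition residue_sum :: "nat \<Rightarrow> int poly \<Rightarrow> nat \<Rightarrow> int" where
  "residue_sum p f r = (\<Sum>i | i \<le> degree f \<and> [i = r] (mod p). coeff f i)"

lemma residue_sum_eq:
  assumes "degree f \<le> D"
  shows "residue_sum p f r = (\<Sum>i | i \<le> D \<and> [i = r] (mod p). coeff f i)"
  unfolding residue_sum_def
  by (rule sum.mono_neutral_left) (use assms in \<open>auto simp: not_le intro: coeff_eq_0\<close>)

lemma residue_sum_cong:
  assumes "[r = s] (mod p)"
  shows "residue_sum p f r = residue_sum p f s"
proof -
  have "[i = r] (mod p) \<longleftrightarrow> [i = s] (mod p)" for i
    using assms by (simp add: cong_def)
  then show ?thesis
    by (simp add: residue_sum_def)
qed

text \<open>Multiplication by x moves class r to class r + 1; indexing by \<open>Suc r\<close>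
  avoids a truncated predecessor.\<close>

lemma residue_sum_mult_linear:
  "residue_sum p ([:-1, 1:] * g) (Suc r) = residue_sum p g r - residue_sum p g (Suc r)"
proof -
  define D where "D = degree g"
  have split: "[:-1, 1:] * g = pCons 0 g - g"
    by simp
  have deg: "degree (pCons 0 g - g) \<le> Suc D"
    unfolding D_def by (intro degree_diff_le) (auto simp: degree_pCons_le)
  have shift: "(\<Sum>i | i \<le> Suc D \<and> [i = Suc r] (mod p). coeff (pCons 0 g) i)
      = (\<Sum>i | i \<le> D \<and> [i = r] (mod p). coeff g i)"
  proof -
    have "(\<Sum>i | i \<le> Suc D \<and> [i = Suc r] (mod p). coeff (pCons 0 g) i)
        = (\<Sum>i \<in> Suc ` {i. i \<le> D \<and> [i = r] (mod p)}. coeff (pCons 0 g) i)"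
    proof (rule sum.mono_neutral_right)
      have "[Suc i = Suc r] (mod p) \<longleftrightarrow> [i = r] (mod p)" for i
        using cong_add_rcancel_nat[of i 1 r p] by simp
      then show "Suc ` {i. i \<le> D \<and> [i = r] (mod p)} \<subseteq> {i. i \<le> Suc D \<and> [i = Suc r] (mod p)}"
        and "\<forall>i\<in>{i. i \<le> Suc D \<and> [i = Suc r] (mod p)} - Suc ` {i. i \<le> D \<and> [i = r] (mod p)}.
          coeff (pCons 0 g) i = 0"
        by (auto simp: coeff_pCons image_iff split: nat.splits)
    qed simp
    also have "\<dots> = (\<Sum>i | i \<le> D \<and> [i = r] (mod p). coeff g i)"
      by (simp add: sum.reindex)
    finally show ?thesis .
  qed
  have "degree g \<le> D" "degree g \<le> Suc D"
    by (simp_all add: D_def)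
  then show ?thesis
    unfolding split residue_sum_eq[OF deg]
    using residue_sum_eq[of g D p r] residue_sum_eq[of g "Suc D" p "Suc r"]
    by (simp add: sum_subtractf shift)
qed

text \<open>The term (-1)^j * (m choose j) * x^(m - j) of (x - 1)^m carries class r + j of g to
  class r + m.\<close>

lemma residue_sum_mult_linear_power:
  "residue_sum p ([:-1, 1:] ^ m * g) (r + m)
     = (\<Sum>j\<le>m. (-1) ^ j * int (m choose j) * residue_sum p g (r + j))"
proof (induction m arbitrary: r)
  case (Suc m)
  let ?d = "\<lambda>j. residue_sum p g (r + j)"
  have "residue_sum p ([:-1, 1:] ^ Suc m * g) (r + Suc m)
      = residue_sum p ([:-1, 1:] ^ m * g) (r + m) - residue_sum p ([:-1, 1:] ^ m * g) (Suc r + m)"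
    using residue_sum_mult_linear[of p "[:-1, 1:] ^ m * g" "r + m"]
    by (simp only: power_Suc mult.assoc add_Suc_right add_Suc)
  also have "\<dots> = (\<Sum>j\<le>m. (-1) ^ j * int (m choose j) * ?d j)
      - (\<Sum>j\<le>m. (-1) ^ j * int (m choose j) * ?d (Suc j))"
    by (simp only: Suc.IH) simp
  \<comment> \<open>The added term is 0 because \<open>m choose Suc m\<close> is 0; splitting off j
    = 0 then aligns both sums for Pascal's rule.\<close>
  also have "(\<Sum>j\<le>m. (-1) ^ j * int (m choose j) * ?d j)
      = (\<Sum>j\<le>Suc m. (-1) ^ j * int (m choose j) * ?d j)"
    by (simp add: binomial_eq_0)
  also have "\<dots> = ?d 0 + (\<Sum>j\<le>m. (-1) ^ Suc j * int (m choose Suc j) * ?d (Suc j))"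
    by (subst sum.atMost_Suc_shift) simp
  also have "\<dots> - (\<Sum>j\<le>m. (-1) ^ j * int (m choose j) * ?d (Suc j))
      = ?d 0 + (\<Sum>j\<le>m. (-1) ^ Suc j * int (Suc m choose Suc j) * ?d (Suc j))"
    by (simp add: sum_subtractf [symmetric] sum.distrib [symmetric] algebra_simps)
  also have "\<dots> = (\<Sum>j\<le>Suc m. (-1) ^ j * int (Suc m choose j) * ?d j)"
    by (simp only: sum.atMost_Suc_shift) simp
  finally show ?case .
qed simp

text \<open>Since 3 divides 9, the shift by 9 in the expansion keeps the class. Collected by j mod
  3, the signed binomials add up to 0, 81 and -81.\<close>

lemma residue_sum_3_dvd:
  assumes "[:-1, 1:] ^ 9 dvd f"
  shows "81 dvd residue_sum 3 f r"
proof -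
  obtain g where f: "f = [:-1, 1:] ^ 9 * g"
    using assms by blast
  define d where "d = residue_sum 3 g"
  have d: "d (Suc (Suc (Suc s))) = d s" for s
    unfolding d_def by (rule residue_sum_cong) (simp add: cong_def)
  have "residue_sum 3 f r = residue_sum 3 f (r + 9)"
    by (rule residue_sum_cong) (simp add: cong_def, presburger)
  also have "\<dots> = (\<Sum>j\<le>9. (-1) ^ j * int (9 choose j) * d (r + j))"
    by (simp only: f residue_sum_mult_linear_power d_def)
  also have "\<dots> = 81 * (d (r + 1) - d (r + 2))"
    by (simp add: eval_nat_numeral d)
  finally show ?thesis
    by simp
qed

lemma residue_sum_5_dvd:
  assumes "[:-1, 1:] ^ 10 dvd f"
  defines "c \<equiv> residue_sum 5 f"
  shows "25 dvd c r"
    and "125 dvd c 1 + 2 * c 2 + 3 * c 3 + 4 * c 4"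
proof -
  obtain g where f: "f = [:-1, 1:] ^ 10 * g"
    using assms by blast
  define d where "d = residue_sum 5 g"
  have d: "d (Suc (Suc (Suc (Suc (Suc s))))) = d s" for s
    unfolding d_def by (rule residue_sum_cong) (simp add: cong_def)
  have c: "c r = - 250 * d r + 200 * d (r + 1) - 75 * d (r + 2) - 75 * d (r + 3) + 200 * d (r + 4)"
    for r
  proof -
    have "c r = residue_sum 5 f (r + 10)"
      unfolding c_def by (rule residue_sum_cong) (simp add: cong_def, presburger)
    also have "\<dots> = (\<Sum>j\<le>10. (-1) ^ j * int (10 choose j) * d (r + j))"
      by (simp only: f residue_sum_mult_linear_power d_def)
    also have "\<dots> = - 250 * d r + 200 * d (r + 1) - 75 * d (r + 2) - 75 * d (r + 3) + 200 * d (r + 4)"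
      by (simp add: eval_nat_numeral d)
    finally show ?thesis .
  qed
  show "25 dvd c r"
    unfolding c by presburger
  \<comment> \<open>Divided by 25, the coefficients in fact \<open>c\<close> have sum 0 and first
    moment divisible by 5, so weighting class r by r gains another factor 5.\<close>
  have "c 1 + 2 * c 2 + 3 * c 3 + 4 * c 4
      = 125 * (5 * d 0 - 3 * d 1 + 3 * d 3 - 5 * d 4)"
    unfolding c by (simp add: eval_nat_numeral d)
  then show "125 dvd c 1 + 2 * c 2 + 3 * c 3 + 4 * c 4"
    by simp
qed

section \<open>Upper bounds from the size and parity of class sums\<close>

lemma residue_sum_littlewood:
  fixes n p r :: nat
  assumes "littlewood n f"
  defines "S \<equiv> {i. i < n \<and> [i = r] (mod p)}"
  shows "\<bar>residue_sum p f r\<bar> \<le> int (card S)"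
    and "even (residue_sum p f r) \<longleftrightarrow> even (card S)"
proof -
  obtain a where a: "\<And>i. i < n \<Longrightarrow> a i \<in> {1, -1 :: int}" and f: "f = (\<Sum>i<n. monom (a i) i)"
    using assms(1) unfolding littlewood_def by blast
  have coeff: "coeff f i = (if i < n then a i else 0)" for i
    by (simp add: f coeff_sum)
  have "degree f \<le> n"
    by (rule degree_le) (simp add: coeff)
  then have "residue_sum p f r = (\<Sum>i | i \<le> n \<and> [i = r] (mod p). coeff f i)"
    by (rule residue_sum_eq)
  also have "\<dots> = (\<Sum>i\<in>S. a i)"
    unfolding S_def by (rule sum.mono_neutral_cong_right) (auto simp: coeff)
  finally have eq: "residue_sum p f r = (\<Sum>i\<in>S. a i)" .
  have fin: "finite S"
    by (simp add: S_def)
  have "\<bar>\<Sum>i\<in>S. a i\<bar> \<le> (\<Sum>i\<in>S. \<bar>a i\<bar>)"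
    by (rule sum_abs)
  also have "\<dots> = int (card S)"
    using a by (subst sum.cong[of S S _ "\<lambda>_. 1"]) (force simp: S_def)+
  finally show "\<bar>residue_sum p f r\<bar> \<le> int (card S)"
    by (simp only: eq)
  have "odd (a i)" if "i \<in> S" for i
    using a[of i] that by (auto simp: S_def)
  then show "even (residue_sum p f r) \<longleftrightarrow> even (card S)"
    unfolding eq by (subst even_sum_iff) (auto simp: fin intro!: arg_cong[where f = even] arg_cong[where f = card])
qed

text \<open>The list form lets \<open>code_simp\<close> compute class sizes.\<close>

lemma card_residue_class:
  "card {i. i < n \<and> [i = r] (mod p)} = length (filter (\<lambda>i. i mod p = r mod p) [0..<n])"
  for n p r :: nat
proof -
  have "{i. i < n \<and> [i = r] (mod p)} = set (filter (\<lambda>i. i mod p = r mod p) [0..<n])"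
    by (auto simp: cong_def)
  then show ?thesis
    by (metis distinct_card distinct_filter distinct_upt)
qed

lemma LP_192_10: "LP 192 10 = {}"
proof -
  have False if f: "littlewood 192 f" and "[:-1, 1:] ^ 10 dvd f" for f
  proof -
    define c where "c = residue_sum 5 f"
    note dvd = residue_sum_5_dvd[OF that(2), folded c_def]
    \<comment> \<open>As 192 = 5 * 38 + 2, class 1 has 39 elements and classes 2, 3, 4 have 38.
      Class 0 has weight 0 in the relation modulo 125, which thus reduces to 125 dividing 25 or
      -25.\<close>
    have odd_class: "c 1 = 25 \<or> c 1 = -25"
    proof -
      have card: "card {i :: nat. i < 192 \<and> [i = 1] (mod 5)} = 39"
        unfolding card_residue_class by code_simp
      show ?thesis
        using residue_sum_littlewood[OF f, of 5 1] dvd(1)[of 1] unfolding card c_def[symmetric]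
        by presburger
    qed
    have even_class: "c r = 0" if "r \<in> {2, 3, 4}" for r
    proof -
      have card: "card {i :: nat. i < 192 \<and> [i = r] (mod 5)} = 38"
        unfolding card_residue_class using that by (elim insertE emptyE; hypsubst; code_simp)
      show ?thesis
        using residue_sum_littlewood[OF f, of 5 r] dvd(1)[of r] unfolding card c_def[symmetric]
        by presburger
    qed
    show False
      using dvd(2) odd_class by (auto simp: even_class)
  qed
  then show ?thesis
    by (auto simp: LP_def)
qed

lemma LP_9_empty:
  fixes n r :: nat
  defines "k \<equiv> card {i. i < n \<and> [i = r] (mod 3)}"
  assumes "odd k" and "k < 81"
  shows "LP n 9 = {}"
proof -
  have False if f: "littlewood n f" and "[:-1, 1:] ^ 9 dvd f" for f
  proof -
    have "\<bar>residue_sum 3 f r\<bar> < 81" "odd (residue_sum 3 f r)"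
      using residue_sum_littlewood[OF f, of 3 r] assms by simp_all
    with residue_sum_3_dvd[OF that(2), of r] show False
      by presburger
  qed
  then show ?thesis
    by (auto simp: LP_def)
qed

lemma LP_208_9: "LP 208 9 = {}"
  \<comment> \<open>Class 1 has 69 elements.\<close>
  by (rule LP_9_empty[where r = 1]; unfold card_residue_class; code_simp)

lemma LP_224_9: "LP 224 9 = {}"
  \<comment> \<open>Class 0 has 75 elements.\<close>
  by (rule LP_9_empty[where r = 0]; unfold card_residue_class; code_simp)

section \<open>Lower bounds from explicit polynomials\<close>

text \<open>Synthetic division by \<open>x - 1\<close> from the constant coefficient upwards, starting with carry \<open>c\<close>.\<close>

primrec div_linear :: "int \<Rightarrow> int list \<Rightarrow> int list" where
  "div_linear c [] = []"
| "div_linear c (x # xs) = (c - x) # div_linear (c - x) xs"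

text \<open>The induction needs an arbitrary initial carry. The top coefficient is the final carry,
  so carry 0 and coefficient sum 0 make the division exact.\<close>

lemma Poly_div_linear:
  "[:-1, 1:] * Poly (div_linear c xs) = Poly xs - [:c:] + monom (c - sum_list xs) (length xs)"
proof (induction xs arbitrary: c)
  case (Cons x xs)
  have "[:-1, 1:] * Poly (div_linear c (x # xs))
      = pCons (x - c) ([:c - x:] + [:-1, 1:] * Poly (div_linear (c - x) xs))"
    by (simp add: algebra_simps)
  also have "\<dots> = pCons (x - c) (Poly xs + monom (c - x - sum_list xs) (length xs))"
    unfolding Cons.IH by simp
  also have "\<dots> = Poly (x # xs) - [:c:] + monom (c - sum_list (x # xs)) (length (x # xs))"
    by (simp add: monom_Suc algebra_simps)
  finally show ?case .
qed (simp add: monom_0)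

text \<open>An executable test for a zero of order at least m at 1: \<open>sum_list xs\<close> is
  the value at 1.\<close>

primrec vanishes :: "nat \<Rightarrow> int list \<Rightarrow> bool" where
  "vanishes 0 xs \<longleftrightarrow> True"
| "vanishes (Suc m) xs \<longleftrightarrow> sum_list xs = 0 \<and> vanishes m (div_linear 0 xs)"

lemma vanishes_dvd: "vanishes m xs \<Longrightarrow> [:-1, 1:] ^ m dvd Poly xs"
proof (induction m arbitrary: xs)
  case (Suc m)
  then have "Poly xs = [:-1, 1:] * Poly (div_linear 0 xs)"
    unfolding Poly_div_linear by simp
  moreover have "[:-1, 1:] * [:-1, 1:] ^ m dvd [:-1, 1:] * Poly (div_linear 0 xs)"
    using Suc by (intro mult_dvd_mono) simp_all
  ultimately show ?case
    by (simp only: power_Suc)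
qed simp

lemma Poly_in_LP:
  assumes "length xs = n" "set xs \<subseteq> {1, -1}" "vanishes m xs"
  shows "Poly xs \<in> LP n m"
proof -
  have "Poly xs = (\<Sum>i<n. monom (xs ! i) i)"
    by (rule poly_eqI) (auto simp: assms(1) coeff_sum nth_default_def)
  then have "littlewood n (Poly xs)"
    using assms(1,2) unfolding littlewood_def by (intro exI[of _ "(!) xs"]) (auto dest!: nth_mem)
  then show ?thesis
    using vanishes_dvd[OF assms(3)] by (simp add: LP_def)
qed

text \<open>Signs are encoded by their run lengths, \<open>s\<close> being the sign of the first run.\<close>

primrec runs :: "int \<Rightarrow> nat list \<Rightarrow> int list" where
  "runs s [] = []"
| "runs s (k # ks) = replicate k s @ runs (- s) ks"

lemma LP_192_9: "LP 192 9 \<noteq> {}"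
proof -
  define h where "h = runs 1
    [4, 2, 2, 1, 2, 1, 1, 1, 2, 1, 1, 3, 3, 1, 1, 4, 3, 1, 2, 1, 1, 2, 1, 2, 3, 4, 2, 3,
     4, 1, 1, 1, 1, 2, 1, 2, 1, 1, 4, 1, 1, 1, 1, 2, 1, 3, 3, 1, 1, 1, 1, 2, 1, 1, 1]"
  \<comment> \<open>The sign makes the polynomial skew-reciprocal, which forces odd multiplicity at
    1, as suits 9.\<close>
  have "Poly (map uminus (rev h) @ h) \<in> LP 192 9"
    unfolding h_def by (rule Poly_in_LP; code_simp)
  then show ?thesis
    by blast
qed

lemma LP_208_8: "LP 208 8 \<noteq> {}"
proof -
  define h where "h = runs 1
    [1, 1, 2, 2, 1, 1, 1, 2, 2, 2, 1, 1, 2, 1, 2, 1, 1, 3, 1, 1, 2, 1, 3, 1, 1, 4, 2, 1,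
     1, 2, 2, 2, 1, 1, 1, 2, 2, 3, 3, 1, 1, 2, 1, 2, 2, 1, 1, 1, 3, 1, 2, 1, 2, 1, 1, 2,
     2, 1, 1, 5, 1, 2, 3]"
  \<comment> \<open>Reciprocal polynomials of odd degree have even multiplicity at 1, as suits
    8.\<close>
  have "Poly (rev h @ h) \<in> LP 208 8"
    unfolding h_def by (rule Poly_in_LP; code_simp)
  then show ?thesis
    by blast
qed

lemma LP_224_8: "LP 224 8 \<noteq> {}"
proof -
  define h where "h = runs 1
    [2, 2, 3, 2, 2, 2, 1, 1, 2, 1, 3, 4, 1, 2, 1, 2, 1, 1, 2, 2, 2, 1, 1, 2, 1, 2, 1, 2,
     2, 1, 1, 2, 1, 2, 2, 1, 4, 2, 2, 2, 4, 1, 1, 2, 2, 4, 1, 2, 4, 1, 1, 3, 1, 2, 2, 1,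
     2, 1, 1, 2, 1, 1, 1]"
  have "Poly (rev h @ h) \<in> LP 224 8"
    unfolding h_def by (rule Poly_in_LP; code_simp)
  then show ?thesis
    by blast
qed

text \<open>Emptiness at \<open>Suc m\<close> excludes every larger order, since lower powers of x -
  1 divide higher ones.\<close>

lemma m_star_eqI:
  assumes "m > 0" "LP n m \<noteq> {}" "LP n (Suc m) = {}"
  shows "m_star n = m"
  unfolding m_star_def
proof (rule Greatest_equality)
  fix k
  assume "k > 0 \<and> LP n k \<noteq> {}"
  then obtain f where f: "littlewood n f" "[:-1, 1:] ^ k dvd f"
    by (auto simp: LP_def)
  show "k \<le> m"
  proof (rule ccontr)
    assume "\<not> k \<le> m"
    then have "[:-1, 1:] ^ Suc m dvd f"
      using f(2) by (meson dvd_trans le_imp_power_dvd not_less_eq_eq)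
    with f(1) assms(3) show False
      by (auto simp: LP_def)
  qed
qed (use assms in simp)

theorem theorem3p3:
  shows "m_star 192 = 9 \<and> m_star 208 = 8 \<and> m_star 224 = 8"
proof (intro conjI)
  show "m_star 192 = 9"
    using LP_192_9 LP_192_10 by (intro m_star_eqI) simp_all
  show "m_star 208 = 8"
    using LP_208_8 LP_208_9 by (intro m_star_eqI) simp_all
  show "m_star 224 = 8"
    using LP_224_8 LP_224_9 by (intro m_star_eqI) simp_all
qed

end
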